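(* Let $\Omega\subset\mathbb{R}^2$ be a strip, i.e. the region between two parallel straight lines. The only minimal graph in $\mathrm{Nil}_3$ over $\Omega$ with zero values on $\partial\Omega$ is the trivial one: if $u$ satisfies $H_u=0$ in $\Omega$ and $u=0$ on $\partial\Omega$, then $u\equiv0$.
   Context: $\mathrm{Nil}_3=\mathrm{Nil}_3(\tau)$, $\tau$ a (non-zero) real constant, is the Heisenberg group: $\mathbb{R}^3$ with the metric $dx^2+dy^2+\left[\tau(y\,dx-x\,dy)+dz\right]^2$. It is a Killing submersion $\pi(x,y,z)=(x,y)$ over the Euclidean plane with Killing field $\xi=\partial_z$ of unit length. The graph of $u$ over a domain of $\mathbb{R}^2$ is the surface $z=u(x,y)$ (Killing graph with respect to the section $z=0$). Its mean curvature is $H_u=\frac12\operatorname{div}\left(\frac{Gu}{\sqrt{1+\|Gu\|^2}}\right)$ with $Gu=(u_x+\tau y,\ u_y-\tau x)$ and Euclidean divergence and norm; the graph is minimal if $H_u=0$. Solutions are functions of class $C^2$ in the interior and continuous up to the boundary. *)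

theory Defs
  imports "HOL-Analysis.Analysis"
begin

definition C1_on :: "(real^2 \<Rightarrow> real) \<Rightarrow> (real^2) set \<Rightarrow> bool" where
  "C1_on f S \<longleftrightarrow>
     (\<forall>p\<in>S. f differentiable (at p)) \<and>
     (\<forall>v. continuous_on S (\<lambda>p. frechet_derivative f (at p) v))"

(* Both notions are meant for open S; values outside S are then irrelevant. *)
definition C2_on :: "(real^2 \<Rightarrow> real) \<Rightarrow> (real^2) set \<Rightarrow> bool" where
  "C2_on f S \<longleftrightarrow> C1_on f S \<and> (\<forall>v. C1_on (\<lambda>p. frechet_derivative f (at p) v) S)"

definition gradient :: "(real^2 \<Rightarrow> real) \<Rightarrow> real^2 \<Rightarrow> real^2" where
  "gradient f p = (\<chi> i. frechet_derivative f (at p) (axis i 1))"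

definition divergence :: "(real^2 \<Rightarrow> real^2) \<Rightarrow> real^2 \<Rightarrow> real" where
  "divergence X p = trace (jacobian X (at p))"

(* Gu = (u_x + tau y, u_y - tau x) for the Killing graph z = u(x,y), relative to the section
   z = 0, in R^3 with the metric dx^2 + dy^2 + (tau (y dx - x dy) + dz)^2. *)
definition nil3_G :: "real \<Rightarrow> (real^2 \<Rightarrow> real) \<Rightarrow> real^2 \<Rightarrow> real^2" where
  "nil3_G \<tau> u p = gradient u p + \<tau> *\<^sub>R vector [p $ 2, - (p $ 1)]"

definition nil3_mean_curvature :: "real \<Rightarrow> (real^2 \<Rightarrow> real) \<Rightarrow> real^2 \<Rightarrow> real" where
  "nil3_mean_curvature \<tau> u p =
     1 / 2 * divergence (\<lambda>q. nil3_G \<tau> u q /\<^sub>R sqrt (1 + (norm (nil3_G \<tau> u q))\<^sup>2)) p"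

(* A function on the closure of the open set \<Omega> is represented by a total function,
   of which only the values on the closure matter. *)
definition nil3_minimal_graph :: "real \<Rightarrow> (real^2) set \<Rightarrow> (real^2 \<Rightarrow> real) \<Rightarrow> bool" where
  "nil3_minimal_graph \<tau> \<Omega> u \<longleftrightarrow>
     C2_on u \<Omega> \<and> continuous_on (closure \<Omega>) u \<and> (\<forall>p\<in>\<Omega>. nil3_mean_curvature \<tau> u p = 0)"

(* The open region between the distinct parallel lines n \<bullet> p = a and n \<bullet> p = b. *)
definition is_strip :: "(real^2) set \<Rightarrow> bool" where
  "is_strip \<Omega> \<longleftrightarrow> (\<exists>n a b. n \<noteq> 0 \<and> a < b \<and> \<Omega> = {p. a < n \<bullet> p \<and> n \<bullet> p < b})"

end

theory Submission
  imports Defs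
begin

text \<open>
  Choose coordinates \<open>s\<close> along and \<open>t\<close> across the strip, \<open>a < t < b\<close>, and let \<open>w\<close> be the minimal graph
  in these coordinates. With \<open>W = \<surd>(1 + |Gw|\<^sup>2)\<close>, \<open>G0 = (\<tau> t, - \<tau> s)\<close> and \<open>V = \<surd>(1 + |G0|\<^sup>2)\<close>, the field
  \<open>(A, B) = Gw / W - G0 / V\<close> is free of divergence, because the zero graph is minimal too. Its inner
  product \<open>D\<close> with the gradient of \<open>w\<close> equals \<open>(W + V) / 2\<close> times the squared distance of the unit normals
  of the two graphs (\<open>unit_normal_identity\<close>). So \<open>D\<close> is nonnegative, it vanishes only where the
  gradient of \<open>w\<close> does, and \<open>V A\<^sup>2 \<le> 2 D\<close> with \<open>V \<ge> \<bar>\<tau>\<bar> \<bar>s\<bar>\<close>.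

  Let \<open>\<phi>\<close> be nondecreasing with \<open>0 \<le> \<phi> \<le> 1\<close>, and zero up to some \<open>\<epsilon> > 0\<close>. The flux
  \<open>\<integral> \<phi>(w) A dt\<close> through a cross-section is bounded by \<open>2 (b - a)\<close>, and its \<open>s\<close>-derivative is the energy
  \<open>\<integral> \<phi>'(w) D dt \<ge> 0\<close> (\<open>flux_deriv\<close>). So it is monotone, and on every interval \<open>[R, 2R]\<close> there are many
  points where the energy is \<open>O(1/R)\<close>.

  No growth condition on \<open>w\<close> is needed, because the energy itself bounds \<open>w\<close>. On one side of the
  strip, where \<open>\<tau> s \<ge> 0\<close>, a positive \<open>wt\<close> that is large compared to \<open>\<bar>\<tau> s\<bar>\<close> forces the two unit normals
  apart, so that \<open>wt \<le> \<bar>\<tau> s\<bar> + 2 D\<close> for large \<open>\<bar>s\<bar>\<close> (\<open>wt_le\<close>); on the other side the same holds for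
  \<open>- wt\<close>. As \<open>w\<close> vanishes at both ends of a cross-section, this one-sided bound suffices to bound
  \<open>\<phi>(w)\<close> (\<open>cutoff_le_energy\<close>). Applied with \<open>\<phi>\<close> stretched by a factor \<open>k\<close> proportional to \<open>R\<close>, it shows that
  \<open>w \<le> \<epsilon> + k\<close> on cross-sections of energy \<open>O(1/R)\<close>, so that \<open>w\<close> grows at most linearly along them.

  On such a cross-section at \<open>s\<close>, the Cauchy-Schwarz inequality bounds the square of the unstretched
  flux by a constant times \<open>k\<^sup>2 / \<bar>s\<bar>\<close> times the unstretched energy (\<open>flux_square_le\<close>), that is by \<open>O(R)\<close>
  times this energy. The cross-section can be chosen so that the unstretched energy is moreover
  \<open>o(1/R)\<close>, since the unstretched flux converges. So the limit of the flux for
  \<open>s \<rightarrow> \<infinity>\<close> is not positive, and by monotonicity the flux is nowhere positive (\<open>flux_nonpos\<close>). In the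
  same way, its behaviour for \<open>s \<rightarrow> -\<infinity>\<close> shows that it is nowhere negative. It is therefore zero, and so
  is the energy. Then \<open>wt = 0\<close> where \<open>w > \<epsilon>\<close>, which gives \<open>w \<le> \<epsilon>\<close>. Finally \<open>- w\<close> is a minimal graph for \<open>- \<tau>\<close>, so that
  \<open>w\<close> is zero.
\<close>

section \<open>Monotonicity of the normalized gradient\<close>

text \<open>Here \<open>(P, Q)\<close> and \<open>(p, q)\<close> play the role of \<open>Gu\<close> for two graphs; \<open>W\<close> and \<open>V\<close> are the
  corresponding area densities. The second identity says that the left-hand side is
  \<open>(W + V) / 2\<close> times the squared distance of the unit normals.\<close>

lemma unit_normal_identity:
  fixes P Q p q :: real
  defines "W \<equiv> sqrt (1 + P\<^sup>2 + Q\<^sup>2)" and "V \<equiv> sqrt (1 + p\<^sup>2 + q\<^sup>2)"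
  shows "(P - p) * (P / W - p / V) + (Q - q) * (Q / W - q / V) = (W + V) * (1 - (1 + P * p + Q * q) / (W * V))"
    and "(P - p) * (P / W - p / V) + (Q - q) * (Q / W - q / V) =
      (W + V) / 2 * ((P / W - p / V)\<^sup>2 + (Q / W - q / V)\<^sup>2 + (1 / W - 1 / V)\<^sup>2)"
proof -
  have W: "W > 0" "W * W = 1 + P\<^sup>2 + Q\<^sup>2" and V: "V > 0" "V * V = 1 + p\<^sup>2 + q\<^sup>2"
    unfolding W_def V_def by (auto simp: add_pos_nonneg real_sqrt_mult_self)
  have "(P - p) * (P / W - p / V) + (Q - q) * (Q / W - q / V)
    = (P\<^sup>2 + Q\<^sup>2) / W + (p\<^sup>2 + q\<^sup>2) / V - (P * p + Q * q) * (W + V) / (W * V)"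
    using W(1) V(1) by (simp add: field_simps power2_eq_square)
  also have "P\<^sup>2 + Q\<^sup>2 = W * W - 1" using W by simp
  also have "p\<^sup>2 + q\<^sup>2 = V * V - 1" using V by simp
  also have "(W * W - 1) / W + (V * V - 1) / V - (P * p + Q * q) * (W + V) / (W * V)
     = (W + V) * (1 - (1 + P * p + Q * q) / (W * V))"
    using W(1) V(1) by (simp add: field_simps)
  finally show 1: "(P - p) * (P / W - p / V) + (Q - q) * (Q / W - q / V) = (W + V) * (1 - (1 + P * p + Q * q) / (W * V))" .
  have "(P / W - p / V)\<^sup>2 + (Q / W - q / V)\<^sup>2 + (1 / W - 1 / V)\<^sup>2
     = (1 + P\<^sup>2 + Q\<^sup>2) / (W * W) + (1 + p\<^sup>2 + q\<^sup>2) / (V * V) - 2 * (1 + P * p + Q * q) / (W * V)"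
    using W(1) V(1) by (simp add: field_simps power2_eq_square)
  also have "\<dots> = 2 * (1 - (1 + P * p + Q * q) / (W * V))"
    using W(1) V(1) unfolding W(2)[symmetric] V(2)[symmetric] by (simp add: field_simps)
  finally show "(P - p) * (P / W - p / V) + (Q - q) * (Q / W - q / V) =
      (W + V) / 2 * ((P / W - p / V)\<^sup>2 + (Q / W - q / V)\<^sup>2 + (1 / W - 1 / V)\<^sup>2)"
    unfolding 1 by simp
qed

lemma unit_normal_monotone:
  fixes P Q p q :: real
  defines "W \<equiv> sqrt (1 + P\<^sup>2 + Q\<^sup>2)" and "V \<equiv> sqrt (1 + p\<^sup>2 + q\<^sup>2)"
  defines "D \<equiv> (P - p) * (P / W - p / V) + (Q - q) * (Q / W - q / V)"
  shows "0 \<le> D" and "V * (P / W - p / V)\<^sup>2 \<le> 2 * D" and "D = 0 \<Longrightarrow> P = p \<and> Q = q"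
proof -
  have W: "W > 0" and V: "V > 0"
    unfolding W_def V_def by (auto simp: add_pos_nonneg)
  have D: "D = (W + V) / 2 * ((P / W - p / V)\<^sup>2 + (Q / W - q / V)\<^sup>2 + (1 / W - 1 / V)\<^sup>2)"
    unfolding D_def W_def V_def by (rule unit_normal_identity(2))
  show "0 \<le> D" unfolding D using W V by simp
  have "V * (P / W - p / V)\<^sup>2 \<le> (W + V) * ((P / W - p / V)\<^sup>2 + (Q / W - q / V)\<^sup>2 + (1 / W - 1 / V)\<^sup>2)"
    using W V by (intro mult_mono) auto
  then show "V * (P / W - p / V)\<^sup>2 \<le> 2 * D" unfolding D by simp
  assume "D = 0"
  then have "(P / W - p / V)\<^sup>2 + (Q / W - q / V)\<^sup>2 + (1 / W - 1 / V)\<^sup>2 = 0"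
    unfolding D using W V by simp
  then have "P / W = p / V \<and> Q / W = q / V \<and> 1 / W = 1 / V"
    by (smt (verit) power_eq_0_iff zero_le_power2 right_minus_eq zero_neq_numeral)
  then show "P = p \<and> Q = q" using W V by auto
qed

text \<open>If the second components have opposite signs and \<open>V\<close> is large compared to \<open>p\<close>, the unit
  normals make an angle of at least 60 degrees, and the monotone expression controls \<open>Q\<close>
  itself. If \<open>Q \<le> 0\<close> the bound is trivial. So only an increase of \<open>Q - q\<close> in the
  direction opposite to \<open>q\<close> is controlled.\<close>

lemma unit_normal_coercive:
  fixes P Q p q :: real
  defines "W \<equiv> sqrt (1 + P\<^sup>2 + Q\<^sup>2)" and "V \<equiv> sqrt (1 + p\<^sup>2 + q\<^sup>2)"
  defines "D \<equiv> (P - p) * (P / W - p / V) + (Q - q) * (Q / W - q / V)"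
  assumes q: "q \<le> 0" and V2: "2 * sqrt (1 + p\<^sup>2) \<le> V"
  shows "Q - q \<le> \<bar>q\<bar> + 2 * D"
proof (cases "Q \<le> 0")
  case True
  have "0 \<le> D" unfolding D_def W_def V_def by (rule unit_normal_monotone(1))
  with True q show ?thesis by simp
next
  case False
  have W: "W > 0" and V: "V > 0"
    unfolding W_def V_def by (auto simp: add_pos_nonneg)
  have D: "D = (W + V) * (1 - (1 + P * p + Q * q) / (W * V))"
    unfolding D_def W_def V_def by (rule unit_normal_identity(1))
  \<comment> \<open>the Cauchy-Schwarz inequality for \<open>(1, P)\<close> and \<open>(1, p)\<close>\<close>
  have "(1 + P * p)\<^sup>2 + (P - p)\<^sup>2 = (1 + P\<^sup>2) * (1 + p\<^sup>2)"
    by (simp add: power2_eq_square algebra_simps)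
  then have "(1 + P * p)\<^sup>2 \<le> (1 + P\<^sup>2) * (1 + p\<^sup>2)"
    by (smt (verit) zero_le_power2)
  then have "1 + P * p \<le> sqrt (1 + P\<^sup>2) * sqrt (1 + p\<^sup>2)"
    by (metis real_le_rsqrt real_sqrt_mult)
  also have "\<dots> \<le> W * (V / 2)"
    using V2 W unfolding W_def by (intro mult_mono real_sqrt_le_mono) auto
  finally have "1 + P * p + Q * q \<le> W * V / 2"
    using False q mult_nonneg_nonpos[of Q q] by simp
  then have "(1 + P * p + Q * q) / (W * V) \<le> 1 / 2"
    using W V by (simp add: field_simps)
  then have "(W + V) * (1 / 2) \<le> D"
    unfolding D using W V by (intro mult_left_mono) auto
  moreover have "Q \<le> W" unfolding W_def by (rule real_le_rsqrt) simp
  ultimately show ?thesis using V q by simp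
qed

section \<open>Cutoff functions\<close>

text \<open>A saturating ramp: it vanishes for \<open>z \<le> 0\<close>, increases to \<open>1\<close>, and is of class \<open>C\<^sup>1\<close>;
  \<open>ramp'\<close> is its derivative. The choice is made so that \<open>ramp\<^sup>2 / ramp'\<close> grows only like \<open>z\<^sup>2\<close>
  although \<open>ramp\<close> is bounded.\<close>

definition ramp :: "real \<Rightarrow> real" where
  "ramp z = (max 0 z / (1 + max 0 z))\<^sup>2"

definition ramp' :: "real \<Rightarrow> real" where
  "ramp' z = 2 * max 0 z / (1 + max 0 z) ^ 3"

lemma ramp_nonpos: "z \<le> 0 \<Longrightarrow> ramp z = 0" and ramp'_nonpos: "z \<le> 0 \<Longrightarrow> ramp' z = 0"
  by (simp_all add: ramp_def ramp'_def)

lemma ramp_nonneg: "0 \<le> ramp z" and ramp'_nonneg: "0 \<le> ramp' z"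
  by (simp_all add: ramp_def ramp'_def)

lemma ramp_le_1: "ramp z \<le> 1"
  by (simp add: ramp_def abs_square_le_1 divide_le_eq)

lemma ramp'_le_1: "ramp' z \<le> 1"
proof -
  have "2 * m \<le> (1 + m) ^ 3" if "0 \<le> m" for m :: real
    using that by (simp add: power3_eq_cube algebra_simps)
  then show ?thesis
    by (simp add: ramp'_def divide_le_eq)
qed

lemma ramp_square_le: "(ramp z)\<^sup>2 \<le> ramp' z * (max 0 z)\<^sup>2 / 2"
proof -
  define m where "m = max 0 z"
  have m: "0 \<le> m" by (simp add: m_def)
  have "(ramp z)\<^sup>2 = (m / (1 + m)) * (m ^ 3 / (1 + m) ^ 3)"
    by (simp add: ramp_def m_def power_divide flip: power_mult power_add power_Suc)
  also have "\<dots> \<le> 1 * (m ^ 3 / (1 + m) ^ 3)"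
    using m by (intro mult_right_mono) auto
  also have "\<dots> = ramp' z * m\<^sup>2 / 2"
    by (simp add: ramp'_def m_def power2_eq_square power3_eq_cube mult_ac)
  finally show ?thesis by (simp add: m_def)
qed

lemma ramp_less_quarter: "ramp z < 1/4 \<Longrightarrow> z < 1"
proof (rule ccontr)
  assume *: "ramp z < 1/4" "\<not> z < 1"
  then have "(1/2)\<^sup>2 \<le> ramp z"
    unfolding ramp_def by (intro power_mono) (auto simp: field_simps)
  with * show False by (simp add: power2_eq_square)
qed

lemma ramp_eq_0: "ramp z = 0 \<Longrightarrow> z \<le> 0"
  by (auto simp: ramp_def max_def split: if_splits)

lemma continuous_on_ramp [continuous_intros]: "continuous_on S f \<Longrightarrow> continuous_on S (\<lambda>x. ramp (f x))"
  unfolding ramp_def by (intro continuous_intros) (auto simp: add_nonneg_eq_0_iff)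

lemma continuous_on_ramp' [continuous_intros]: "continuous_on S f \<Longrightarrow> continuous_on S (\<lambda>x. ramp' (f x))"
  unfolding ramp'_def by (intro continuous_intros) (auto simp: add_nonneg_eq_0_iff)

lemma ramp_has_derivative: "(ramp has_real_derivative ramp' z) (at z)"
proof (cases z "0::real" rule: linorder_cases)
  case less
  have "((\<lambda>_. 0) has_real_derivative 0) (at z)" by simp
  then have "(ramp has_real_derivative 0) (at z)"
    by (rule has_field_derivative_transform_within_open[where S = "{..<0}"])
       (use less in \<open>auto simp: ramp_nonpos\<close>)
  then show ?thesis using less by (simp add: ramp'_nonpos)
next
  case greater
  have "((\<lambda>z. z / (1 + z)) has_real_derivative 1 / (1 + z)\<^sup>2) (at z)"
    using greater by (auto intro!: derivative_eq_intros simp: power2_eq_square)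
  from DERIV_power[OF this, of 2]
  have "((\<lambda>z. (z / (1 + z))\<^sup>2) has_real_derivative 2 * z / (1 + z) ^ 3) (at z)"
    by (rule DERIV_cong) (simp add: power2_eq_square power3_eq_cube)
  then have "(ramp has_real_derivative 2 * z / (1 + z) ^ 3) (at z)"
    by (rule has_field_derivative_transform_within_open[where S = "{0<..}"])
       (use greater in \<open>auto simp: ramp_def\<close>)
  then show ?thesis using greater by (simp add: ramp'_def)
next
  case equal
  have *: "norm ((ramp (0 + h) - ramp 0) / h) \<le> norm h" for h
  proof (cases "h \<le> 0")
    case False
    then have "ramp h = h\<^sup>2 / (1 + h)\<^sup>2" by (simp add: ramp_def power_divide)
    also have "\<dots> \<le> h\<^sup>2 / 1" using False by (intro divide_left_mono) (auto)
    finally have "ramp h \<le> h * h" by (simp add: power2_eq_square)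
    then show ?thesis using False ramp_nonneg[of h] by (simp add: ramp_nonpos divide_le_eq)
  qed (simp add: ramp_nonpos)
  have "((\<lambda>h::real. norm h) \<longlongrightarrow> 0) (at 0)"
    by (intro tendsto_norm_zero tendsto_ident_at)
  then have "((\<lambda>h. (ramp (0 + h) - ramp 0) / h) \<longlongrightarrow> 0) (at 0)"
    by (rule Lim_null_comparison[OF always_eventually[OF allI[OF *]]])
  then show ?thesis using equal by (simp add: DERIV_def ramp'_nonpos)
qed

text \<open>A cutoff at level \<open>\<epsilon>\<close>: a nondecreasing \<open>C\<^sup>1\<close> function \<open>\<phi>\<close> with values in \<open>[0, 1]\<close> and
  derivative \<open>\<phi>'\<close> that vanishes up to the positive level \<open>\<epsilon>\<close>. Composed with a continuous function with
  zero boundary values it gives one that vanishes near the boundary, so that nothing has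
  to be known about the gradient there.\<close>

definition cutoff :: "real \<Rightarrow> (real \<Rightarrow> real) \<Rightarrow> (real \<Rightarrow> real) \<Rightarrow> bool" where
  "cutoff \<epsilon> \<phi> \<phi>' \<longleftrightarrow> 0 < \<epsilon> \<and> (\<forall>z. (\<phi> has_real_derivative \<phi>' z) (at z)) \<and>
     continuous_on UNIV \<phi>' \<and> (\<forall>z\<le>\<epsilon>. \<phi> z = 0 \<and> \<phi>' z = 0) \<and>
     (\<forall>z. 0 \<le> \<phi> z \<and> \<phi> z \<le> 1 \<and> 0 \<le> \<phi>' z)"

section \<open>Decay of bounded monotone fluxes\<close>

text \<open>\<open>F\<close> and all \<open>G k\<close> are bounded and nondecreasing. If \<open>F\<close> had a positive value, then on
  \<open>[R, 2R]\<close> with \<open>R\<close> large there would be a point where \<open>G k'\<close> is \<open>O(1/R)\<close> and \<open>F'\<close> is much smaller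
  than \<open>1/R\<close>: the total increase of \<open>G k\<close> on this interval is bounded, and that of \<open>F\<close> is small.
  With \<open>k\<close> proportional to \<open>R\<close> the last hypothesis then makes \<open>F\<^sup>2\<close> small at this point,
  while monotonicity keeps \<open>F\<close> away from zero.\<close>

lemma flux_nonpos:
  fixes F F' :: "real \<Rightarrow> real" and G G' :: "real \<Rightarrow> real \<Rightarrow> real"
  assumes C: "0 < C"
    and dF: "\<And>s. (F has_real_derivative F' s) (at s)"
    and F'_nonneg: "\<And>s. 0 \<le> F' s" and F_le: "\<And>s. \<bar>F s\<bar> \<le> C"
    and dG: "\<And>k s. 0 < k \<Longrightarrow> (G k has_real_derivative G' k s) (at s)"
    and G'_nonneg: "\<And>k s. 0 < k \<Longrightarrow> 0 \<le> G' k s" and G_le: "\<And>k s. 0 < k \<Longrightarrow> \<bar>G k s\<bar> \<le> C"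
    and main: "\<And>k s. 0 < k \<Longrightarrow> s0 \<le> s \<Longrightarrow> 0 < s \<Longrightarrow> C * s / k + C * G' k s < 1 / 4 \<Longrightarrow>
         (F s)\<^sup>2 \<le> C * k\<^sup>2 * F' s / s"
  shows "F x \<le> 0"
proof (rule ccontr)
  assume "\<not> F x \<le> 0"
  then have Fx: "0 < F x" by simp
  have mono: "F s \<le> F t" if "s \<le> t" for s t
    using DERIV_nonneg_imp_nondecreasing[OF that] dF F'_nonneg by blast
  \<comment> \<open>\<open>\<mu>\<close> is a small bound for the increase of \<open>F\<close>; the weight \<open>l\<close> of \<open>F\<close> against \<open>G k\<close> is large, so
    that the increase of \<open>G k\<close> hardly counts in the bound for \<open>F'\<close>\<close>
  define \<mu> where "\<mu> = (F x)\<^sup>2 / (1024 * C ^ 3)"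
  have \<mu>: "0 < \<mu>" using Fx C by (simp add: \<mu>_def)
  define l where "l = 2 * C / \<mu>"
  have l: "0 < l" using \<mu> C by (simp add: l_def)
  define R0 where "R0 = max 1 (max s0 (max x (8 * C * (2 * C + l * \<mu>) + 1)))"
  \<comment> \<open>being bounded and monotone, \<open>F\<close> increases by less than \<open>\<mu>\<close> on some dyadic interval\<close>
  have "convergent (\<lambda>n. F (R0 * 2 ^ n))"
  proof (rule Bseq_monoseq_convergent)
    show "Bseq (\<lambda>n. F (R0 * 2 ^ n))" by (rule BseqI'[where K = C]) (simp add: F_le)
    show "monoseq (\<lambda>n. F (R0 * 2 ^ n))"
      by (rule monoI1) (auto intro!: mono mult_left_mono simp: R0_def)
  qed
  then obtain L where L: "(\<lambda>n. F (R0 * 2 ^ n)) \<longlonglongrightarrow> L" by (auto simp: convergent_def)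
  have "(\<lambda>n. F (R0 * 2 ^ Suc n) - F (R0 * 2 ^ n)) \<longlonglongrightarrow> L - L"
    by (intro tendsto_diff L LIMSEQ_Suc[OF L])
  then have "\<forall>\<^sub>F n in sequentially. F (R0 * 2 ^ Suc n) - F (R0 * 2 ^ n) < \<mu>"
    using \<mu> by (intro order_tendstoD) auto
  then obtain n where n: "F (R0 * 2 ^ Suc n) - F (R0 * 2 ^ n) < \<mu>"
    by (meson eventually_happens sequentially_bot)
  define R where "R = R0 * 2 ^ n"
  have osc: "F (2 * R) - F R < \<mu>" using n by (simp add: R_def mult_ac)
  have "R0 * 1 \<le> R" unfolding R_def by (rule mult_left_mono) (auto simp: R0_def)
  then have R: "1 \<le> R" "s0 \<le> R" "x \<le> R" "8 * C * (2 * C + l * \<mu>) < R"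
    by (auto simp: R0_def)
  define k where "k = 16 * C * R"
  have k: "0 < k" using C R by (simp add: k_def)
  \<comment> \<open>one application of the mean value theorem bounds both derivatives at the same point\<close>
  have "\<exists>z>R. z < 2 * R \<and> (G k (2 * R) + l * F (2 * R)) - (G k R + l * F R)
      = (2 * R - R) * (G' k z + l * F' z)"
    by (rule MVT2) (use R dG[OF k] dF in \<open>auto intro!: derivative_eq_intros\<close>)
  then obtain z where z: "R < z" "z < 2 * R"
    and eq: "(G k (2 * R) + l * F (2 * R)) - (G k R + l * F R) = R * (G' k z + l * F' z)"
    by auto
  have "G k (2 * R) - G k R \<le> 2 * C"
    using G_le[OF k, of R] G_le[OF k, of "2 * R"] by simp
  moreover have "l * (F (2 * R) - F R) \<le> l * \<mu>" using osc l by simp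
  ultimately have *: "R * (G' k z + l * F' z) \<le> 2 * C + l * \<mu>"
    unfolding eq[symmetric] by (simp add: algebra_simps)
  have nn: "0 \<le> G' k z" "0 \<le> l * F' z" using G'_nonneg[OF k] F'_nonneg l by auto
  have "R * G' k z \<le> 2 * C + l * \<mu>"
    using * nn R by (smt (verit) distrib_left mult_nonneg_nonneg)
  then have "8 * C * (R * G' k z) \<le> 8 * C * (2 * C + l * \<mu>)"
    using C by (intro mult_left_mono) auto
  also have "\<dots> < R * 1" using R by simp
  finally have "R * (8 * C * G' k z) < R * 1" by (simp add: mult_ac)
  then have G'z: "C * G' k z < 1 / 8"
    using R by auto
  have "C * z / k \<le> C * (2 * R) / k"
    using z C k by (intro divide_right_mono mult_left_mono) auto
  also have "\<dots> = 1 / 8" using C R by (simp add: k_def)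
  finally have "C * z / k + C * G' k z < 1 / 4" using G'z by linarith
  then have Fz: "(F z)\<^sup>2 \<le> C * k\<^sup>2 * F' z / z"
    using z R k by (intro main) auto
  have "R * (l * F' z) \<le> 2 * C + l * \<mu>"
    using * nn R by (smt (verit) distrib_left mult_nonneg_nonneg)
  then have "l * (R * F' z) \<le> l * (2 * \<mu>)"
    using \<mu> C by (simp add: l_def algebra_simps)
  then have RF': "R * F' z \<le> 2 * \<mu>" using l by simp
  have "C * k\<^sup>2 * F' z / z \<le> C * k\<^sup>2 * F' z / R"
    using z R C k F'_nonneg by (intro divide_left_mono) auto
  also have "\<dots> = 256 * C ^ 3 * (R * F' z)"
    using R by (simp add: k_def power2_eq_square power3_eq_cube)
  also have "\<dots> \<le> 256 * C ^ 3 * (2 * \<mu>)"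
    using RF' C by (intro mult_left_mono) auto
  also have "\<dots> = (F x)\<^sup>2 / 2" using C by (simp add: \<mu>_def)
  also have "\<dots> < (F x)\<^sup>2" using Fx by simp
  also have "\<dots> \<le> (F z)\<^sup>2"
    using Fx mono[of x z] z R by (intro power_mono) auto
  finally show False using Fz by simp
qed

section \<open>Minimal graphs in strip coordinates\<close>

lemma integral_square_le:
  fixes f :: "real \<Rightarrow> real"
  assumes ab: "a < b" and f: "continuous_on {a..b} f"
  shows "(integral {a..b} f)\<^sup>2 \<le> (b - a) * integral {a..b} (\<lambda>t. (f t)\<^sup>2)"
proof -
  define m where "m = integral {a..b} f / (b - a)"
  have int: "f integrable_on {a..b}" "(\<lambda>t. (f t)\<^sup>2) integrable_on {a..b}"
    by (intro integrable_continuous_real continuous_intros f)+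
  have "0 \<le> integral {a..b} (\<lambda>t. (f t - m)\<^sup>2)"
    by (intro integral_nonneg integrable_continuous_real continuous_intros f) auto
  also have "(\<lambda>t. (f t - m)\<^sup>2) = (\<lambda>t. (f t)\<^sup>2 - 2 * m * f t + m\<^sup>2)"
    by (simp add: power2_eq_square algebra_simps)
  also have "integral {a..b} \<dots> = integral {a..b} (\<lambda>t. (f t)\<^sup>2) - 2 * m * integral {a..b} f + m\<^sup>2 * (b - a)"
    using has_integral_add[OF has_integral_diff[OF integrable_integral[OF int(2)]
        has_integral_mult_right[OF integrable_integral[OF int(1)], of "2 * m"]]
        has_integral_const_real[of "m\<^sup>2" a b]] ab
    by (intro integral_unique) (simp add: mult.commute)
  finally have "0 \<le> (b - a) * (integral {a..b} (\<lambda>t. (f t)\<^sup>2) - 2 * m * integral {a..b} f + m\<^sup>2 * (b - a))"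
    using ab by simp
  also have "\<dots> = (b - a) * integral {a..b} (\<lambda>t. (f t)\<^sup>2)
      - 2 * (m * (b - a)) * integral {a..b} f + (m * (b - a))\<^sup>2"
    by (simp add: power2_eq_square algebra_simps)
  also have "m * (b - a) = integral {a..b} f" using ab by (simp add: m_def)
  finally show ?thesis by (simp add: power2_eq_square)
qed

text \<open>A minimal graph with zero boundary values over the strip \<open>a < t < b\<close>, in coordinates \<open>s\<close> along
  and \<open>t\<close> across the strip. The partial derivatives of \<open>w\<close> are \<open>ws\<close> and \<open>wt\<close>. The minimal surface
  equation is encoded by one continuous function \<open>C\<close>, which is the \<open>s\<close>-derivative of the first
  component of \<open>Gw / \<surd>(1 + |Gw|\<^sup>2)\<close> and minus the \<open>t\<close>-derivative of the second.\<close>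

locale strip_graph =
  fixes \<tau> a b :: real and w ws wt C :: "real \<times> real \<Rightarrow> real"
  assumes a_less_b: "a < b" and tau: "\<tau> \<noteq> 0"
    and cont_w: "continuous_on (UNIV \<times> {a..b}) w"
    and w_bottom: "\<And>s. w (s, a) = 0" and w_top: "\<And>s. w (s, b) = 0"
    and w_deriv_s: "\<And>s t. a < t \<Longrightarrow> t < b \<Longrightarrow> ((\<lambda>s. w (s, t)) has_real_derivative ws (s, t)) (at s)"
    and w_deriv_t: "\<And>s t. a < t \<Longrightarrow> t < b \<Longrightarrow> ((\<lambda>t. w (s, t)) has_real_derivative wt (s, t)) (at t)"
    and cont_ws: "continuous_on (UNIV \<times> {a<..<b}) ws"
    and cont_wt: "continuous_on (UNIV \<times> {a<..<b}) wt"
    and cont_C: "continuous_on (UNIV \<times> {a<..<b}) C"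
    and deriv_s: "\<And>s t. a < t \<Longrightarrow> t < b \<Longrightarrow>
      ((\<lambda>s. (ws (s, t) + \<tau> * t) / sqrt (1 + (ws (s, t) + \<tau> * t)\<^sup>2 + (wt (s, t) - \<tau> * s)\<^sup>2))
        has_real_derivative C (s, t)) (at s)"
    and deriv_t: "\<And>s t. a < t \<Longrightarrow> t < b \<Longrightarrow>
      ((\<lambda>t. (wt (s, t) - \<tau> * s) / sqrt (1 + (ws (s, t) + \<tau> * t)\<^sup>2 + (wt (s, t) - \<tau> * s)\<^sup>2))
        has_real_derivative - C (s, t)) (at t)"
begin

text \<open>\<open>W\<close> and \<open>V\<close> are the area densities of \<open>w\<close> and of the zero graph. The field \<open>(A, B)\<close> is the
  difference of \<open>Gw / W\<close> and \<open>G0 / V\<close> with \<open>G0 = (\<tau> t, - \<tau> s)\<close>; it is free of divergence, with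
  \<open>E\<close> the \<open>s\<close>-derivative of \<open>A\<close>. \<open>D\<close> is the inner product of \<open>(A, B)\<close> with the gradient of \<open>w\<close>.\<close>

definition V :: "real \<times> real \<Rightarrow> real" where
  "V z = sqrt (1 + (\<tau> * snd z)\<^sup>2 + (- (\<tau> * fst z))\<^sup>2)"

definition W :: "real \<times> real \<Rightarrow> real" where
  "W z = sqrt (1 + (ws z + \<tau> * snd z)\<^sup>2 + (wt z - \<tau> * fst z)\<^sup>2)"

definition A :: "real \<times> real \<Rightarrow> real" where
  "A z = (ws z + \<tau> * snd z) / W z - \<tau> * snd z / V z"

definition B :: "real \<times> real \<Rightarrow> real" where
  "B z = (wt z - \<tau> * fst z) / W z - - (\<tau> * fst z) / V z"

definition D :: "real \<times> real \<Rightarrow> real" where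
  "D z = ws z * A z + wt z * B z"

definition E :: "real \<times> real \<Rightarrow> real" where
  "E z = C z + \<tau> ^ 3 * fst z * snd z / V z ^ 3"

lemma V_pos: "0 < V z" and W_pos: "0 < W z"
  unfolding V_def W_def by (auto simp: add_pos_nonneg)

lemma V_nonzero [simp]: "V z \<noteq> 0" and W_nonzero [simp]: "W z \<noteq> 0"
  using V_pos[of z] W_pos[of z] by auto

lemma D_eq:
  "D z = ((ws z + \<tau> * snd z) - \<tau> * snd z) * A z + ((wt z - \<tau> * fst z) - - (\<tau> * fst z)) * B z"
  by (simp add: D_def)

lemma D_nonneg: "0 \<le> D z" and A_square_le: "V z * (A z)\<^sup>2 \<le> 2 * D z"
  and D_eq_0: "D z = 0 \<Longrightarrow> wt z = 0"
  using unit_normal_monotone[where P = "ws z + \<tau> * snd z" and Q = "wt z - \<tau> * fst z"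
      and p = "\<tau> * snd z" and q = "- (\<tau> * fst z)"]
  unfolding D_eq A_def B_def V_def W_def by auto

lemma abs_A_le: "\<bar>A z\<bar> \<le> 2"
proof -
  have "\<bar>(ws z + \<tau> * snd z) / W z\<bar> \<le> 1"
    using W_pos[of z] unfolding W_def by (simp add: abs_le_iff divide_le_eq le_divide_eq)
      (smt (verit) real_le_rsqrt power2_minus zero_le_power2)
  moreover have "\<bar>\<tau> * snd z / V z\<bar> \<le> 1"
    using V_pos[of z] unfolding V_def by (simp add: abs_le_iff divide_le_eq le_divide_eq)
      (smt (verit) real_le_rsqrt power2_minus zero_le_power2)
  ultimately show ?thesis unfolding A_def by linarith
qed

lemma le_V: "\<bar>\<tau>\<bar> * \<bar>s\<bar> \<le> V (s, t)"
  unfolding V_def by (rule real_le_rsqrt) (simp add: power_mult_distrib)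

lemma cont_V: "continuous_on S V" and cont_W: "continuous_on (UNIV \<times> {a<..<b}) W"
  unfolding V_def W_def by (intro continuous_intros cont_ws cont_wt)+

lemma cont_A: "continuous_on (UNIV \<times> {a<..<b}) A"
  and cont_B: "continuous_on (UNIV \<times> {a<..<b}) B"
  unfolding A_def B_def
  by (auto intro!: continuous_intros cont_ws cont_wt cont_V cont_W)

lemma cont_D: "continuous_on (UNIV \<times> {a<..<b}) D"
  unfolding D_def by (intro continuous_intros cont_ws cont_wt cont_A cont_B)

lemma cont_E: "continuous_on (UNIV \<times> {a<..<b}) E"
  unfolding E_def by (auto intro!: continuous_intros cont_C cont_V)

lemma deriv_V:
  "((\<lambda>s. V (s, t)) has_real_derivative \<tau>\<^sup>2 * s / V (s, t)) (at s)"
  "((\<lambda>t. V (s, t)) has_real_derivative \<tau>\<^sup>2 * t / V (s, t)) (at t)"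
  using V_pos[of "(s, t)"] unfolding V_def
  by (auto intro!: derivative_eq_intros simp: field_simps power2_eq_square)

lemma deriv_A: "a < t \<Longrightarrow> t < b \<Longrightarrow> ((\<lambda>s. A (s, t)) has_real_derivative E (s, t)) (at s)"
proof -
  assume t: "a < t" "t < b"
  have "((\<lambda>s. \<tau> * t / V (s, t)) has_real_derivative - (\<tau> ^ 3 * s * t / V (s, t) ^ 3)) (at s)"
    using V_pos[of "(s, t)"]
    by (auto intro!: derivative_eq_intros deriv_V(1) simp: field_simps power2_eq_square power3_eq_cube)
  from DERIV_diff[OF deriv_s[OF t, of s] this] show ?thesis
    by (simp add: A_def W_def E_def)
qed

lemma deriv_B: "a < t \<Longrightarrow> t < b \<Longrightarrow> ((\<lambda>t. B (s, t)) has_real_derivative - E (s, t)) (at t)"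
proof -
  assume t: "a < t" "t < b"
  have "((\<lambda>t. - (\<tau> * s) / V (s, t)) has_real_derivative \<tau> ^ 3 * s * t / V (s, t) ^ 3) (at t)"
    using V_pos[of "(s, t)"]
    by (auto intro!: derivative_eq_intros deriv_V(2) simp: field_simps power2_eq_square power3_eq_cube)
  from DERIV_diff[OF deriv_t[OF t, of s] this] show ?thesis
    by (simp add: B_def W_def E_def)
qed

text \<open>Near the boundary the product is zero, whatever \<open>g\<close> does there; at \<open>t = a\<close> and \<open>t = b\<close>
  themselves the arbitrary values of \<open>g\<close> are multiplied by zero.\<close>

lemma cont_cutoff:
  assumes \<psi>: "continuous_on UNIV \<psi>" "\<forall>z\<le>\<epsilon>. \<psi> z = (0::real)" and "0 < \<epsilon>"
    and g: "continuous_on (UNIV \<times> {a<..<b}) g"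
  shows "continuous_on (UNIV \<times> {a..b}) (\<lambda>z. \<psi> (w z) * g z)"
proof -
  let ?X = "UNIV \<times> {a..b} :: (real \<times> real) set"
  let ?S = "UNIV \<times> {a<..<b} :: (real \<times> real) set"
  let ?T = "?X \<inter> w -` {..<\<epsilon>}"
  have eq: "?X = ?S \<union> ?T"
  proof (intro equalityI subsetI)
    fix z assume z: "z \<in> ?X"
    show "z \<in> ?S \<union> ?T"
    proof (cases "z \<in> ?S")
      case False
      with z have "snd z = a \<or> snd z = b" by (cases z) force
      then have "w z = 0" using w_bottom w_top by (cases z) auto
      then show ?thesis using z \<open>0 < \<epsilon>\<close> by simp
    qed simp
  qed auto
  have S: "openin (top_of_set ?X) ?S"
    by (intro open_subset) (auto intro: open_Times)
  have T: "openin (top_of_set ?X) ?T"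
    by (rule continuous_openin_preimage_gen[OF cont_w]) simp
  have "continuous_on ?S (\<lambda>z. \<psi> (w z) * g z)"
    by (intro continuous_intros g continuous_on_compose2[OF \<psi>(1)] continuous_on_subset[OF cont_w]) auto
  moreover have "continuous_on ?T (\<lambda>z. \<psi> (w z) * g z)"
    by (rule continuous_on_eq[OF continuous_on_const[of _ 0]]) (auto simp: \<psi>(2))
  ultimately show ?thesis
    by (rule continuous_on_Un_local_open[of ?S ?T, folded eq, OF S T])
qed

lemma cont_slice:
  assumes "continuous_on (UNIV \<times> {a..b}) f"
  shows "continuous_on {a..b} (\<lambda>t. f (s, t))"
  by (rule continuous_on_compose2[OF assms]) (auto intro!: continuous_intros)

context
  fixes \<phi> \<phi>' :: "real \<Rightarrow> real" and \<epsilon> :: real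
  assumes cutoff: "cutoff \<epsilon> \<phi> \<phi>'"
begin

lemma eps: "0 < \<epsilon>"
  and deriv_\<phi>: "(\<phi> has_real_derivative \<phi>' z) (at z)"
  and cont_\<phi>': "continuous_on UNIV \<phi>'"
  and \<phi>_0: "\<forall>z\<le>\<epsilon>. \<phi> z = 0" and \<phi>'_0: "\<forall>z\<le>\<epsilon>. \<phi>' z = 0"
  and \<phi>_range: "0 \<le> \<phi> z" "\<phi> z \<le> 1" and \<phi>'_nonneg: "0 \<le> \<phi>' z"
  using cutoff by (auto simp: cutoff_def)

lemma cont_\<phi>: "continuous_on UNIV \<phi>"
  by (rule DERIV_continuous_on[OF has_field_derivative_at_within[OF deriv_\<phi>]])

lemmas cont_\<phi>_mult = cont_cutoff[OF cont_\<phi> \<phi>_0 eps]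
lemmas cont_\<phi>'_mult = cont_cutoff[OF cont_\<phi>' \<phi>'_0 eps]

text \<open>The flux of \<open>\<phi>(w) (A, B)\<close> through the cross-section at \<open>s\<close>, and the cross-sectional density
  of the energy \<open>\<phi>'(w) D\<close>.\<close>

definition flux :: "real \<Rightarrow> real" where
  "flux s = integral {a..b} (\<lambda>t. \<phi> (w (s, t)) * A (s, t))"

definition energy :: "real \<Rightarrow> real" where
  "energy s = integral {a..b} (\<lambda>t. \<phi>' (w (s, t)) * D (s, t))"

text \<open>The divergence theorem on thin slices: differentiation under the integral sign, and no flux
  through the boundary lines because \<open>\<phi>(w)\<close> vanishes near them.\<close>

lemma flux_deriv: "(flux has_real_derivative energy s) (at s)"
proof -
  define f where "f = (\<lambda>s t. \<phi> (w (s, t)) * A (s, t))"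
  define fx where "fx = (\<lambda>s t. \<phi>' (w (s, t)) * (ws (s, t) * A (s, t)) + \<phi> (w (s, t)) * E (s, t))"
  have cont_fx: "continuous_on (UNIV \<times> {a..b}) (\<lambda>(s, t). fx s t)"
    unfolding fx_def case_prod_beta prod.collapse
    by (intro continuous_on_add cont_\<phi>_mult cont_\<phi>'_mult continuous_on_mult cont_ws cont_A cont_E)
  have fx: "((\<lambda>s. f s t) has_real_derivative fx s t) (at s)" if "t \<in> {a..b}" for s t
  proof (cases "t = a \<or> t = b")
    case True
    then have "(\<lambda>s. f s t) = (\<lambda>s. 0)" "fx s t = 0"
      using eps by (auto simp: f_def fx_def w_bottom w_top \<phi>_0 \<phi>'_0)
    then show ?thesis by simp
  next
    case False
    with that have t: "a < t" "t < b" by auto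
    show ?thesis unfolding f_def fx_def
      by (auto intro!: derivative_eq_intros DERIV_chain2[OF deriv_\<phi>] w_deriv_s deriv_A t)
  qed
  have "((\<lambda>s. integral (cbox a b) (f s)) has_real_derivative integral (cbox a b) (fx s)) (at s within UNIV)"
  proof (rule leibniz_rule_field_derivative)
    show "f s integrable_on cbox a b" for s
      unfolding f_def box_real
      by (intro integrable_continuous_real cont_slice[OF cont_\<phi>_mult[OF cont_A]])
  qed (use fx cont_fx in auto)
  then have 1: "(flux has_real_derivative integral {a..b} (fx s)) (at s)"
    by (simp add: f_def flux_def[abs_def])
  have 2: "((\<lambda>t. \<phi>' (w (s, t)) * (wt (s, t) * B (s, t)) - \<phi> (w (s, t)) * E (s, t)) has_integral
      \<phi> (w (s, b)) * B (s, b) - \<phi> (w (s, a)) * B (s, a)) {a..b}"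
  proof (rule fundamental_theorem_of_calculus_interior)
    show "continuous_on {a..b} (\<lambda>t. \<phi> (w (s, t)) * B (s, t))"
      by (intro cont_slice[OF cont_\<phi>_mult[OF cont_B]])
    fix t assume "t \<in> {a<..<b}"
    then have t: "a < t" "t < b" by auto
    show "((\<lambda>t. \<phi> (w (s, t)) * B (s, t)) has_vector_derivative
       \<phi>' (w (s, t)) * (wt (s, t) * B (s, t)) - \<phi> (w (s, t)) * E (s, t)) (at t)"
      unfolding has_real_derivative_iff_has_vector_derivative[symmetric]
      by (auto intro!: derivative_eq_intros DERIV_chain2[OF deriv_\<phi>] w_deriv_t deriv_B t)
  qed (use a_less_b in simp)
  have "(fx s has_integral integral {a..b} (fx s)) {a..b}"
    unfolding has_integral_integral[symmetric]
    using cont_slice[OF cont_fx] by (intro integrable_continuous_real) simp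
  from has_integral_add[OF this 2]
  have "((\<lambda>t. \<phi>' (w (s, t)) * D (s, t)) has_integral integral {a..b} (fx s)) {a..b}"
    using eps by (simp add: fx_def D_def w_bottom w_top \<phi>_0 algebra_simps)
  then have "integral {a..b} (fx s) = energy s"
    unfolding energy_def by (simp add: integral_unique)
  with 1 show ?thesis by simp
qed

lemma energy_nonneg: "0 \<le> energy s"
  unfolding energy_def
  by (intro integral_nonneg integrable_continuous_real cont_slice[OF cont_\<phi>'_mult[OF cont_D]])
     (simp add: \<phi>'_nonneg D_nonneg)

lemma abs_flux_le: "\<bar>flux s\<bar> \<le> 2 * (b - a)"
proof -
  have "norm (flux s) \<le> integral {a..b} (\<lambda>t. 2)"
    unfolding flux_def
  proof (rule integral_norm_bound_integral)
    show "(\<lambda>t. \<phi> (w (s, t)) * A (s, t)) integrable_on {a..b}"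
      by (intro integrable_continuous_real cont_slice[OF cont_\<phi>_mult[OF cont_A]])
    show "norm (\<phi> (w (s, t)) * A (s, t)) \<le> 2" for t
      using mult_mono[OF \<phi>_range(2)[of "w (s, t)"] abs_A_le[of "(s, t)"]] \<phi>_range(1)
      by (simp add: abs_mult)
  qed auto
  then show ?thesis using a_less_b by simp
qed

text \<open>By the Cauchy-Schwarz inequality. The gain of a factor \<open>\<bar>s\<bar>\<close> over the analogous estimate in
  Euclidean space is due to \<open>V \<ge> \<bar>\<tau>\<bar> \<bar>s\<bar>\<close>.\<close>

lemma flux_square_le:
  assumes M: "\<And>t. t \<in> {a..b} \<Longrightarrow> (\<phi> (w (s, t)))\<^sup>2 \<le> M\<^sup>2 / 2 * \<phi>' (w (s, t))"
    and s: "s \<noteq> 0"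
  shows "(flux s)\<^sup>2 \<le> (b - a) * M\<^sup>2 / (\<bar>\<tau>\<bar> * \<bar>s\<bar>) * energy s"
proof -
  have c: "continuous_on {a..b} (\<lambda>t. \<phi> (w (s, t)) * A (s, t))"
    "continuous_on {a..b} (\<lambda>t. \<phi>' (w (s, t)) * D (s, t))"
    by (intro cont_slice[OF cont_\<phi>_mult[OF cont_A]] cont_slice[OF cont_\<phi>'_mult[OF cont_D]])+
  have pos: "0 < \<bar>\<tau>\<bar> * \<bar>s\<bar>" using s tau by simp
  have "(flux s)\<^sup>2 \<le> (b - a) * integral {a..b} (\<lambda>t. (\<phi> (w (s, t)) * A (s, t))\<^sup>2)"
    unfolding flux_def by (rule integral_square_le[OF a_less_b c(1)])
  also have "\<dots> \<le> (b - a) * integral {a..b} (\<lambda>t. M\<^sup>2 / (\<bar>\<tau>\<bar> * \<bar>s\<bar>) * (\<phi>' (w (s, t)) * D (s, t)))"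
  proof (intro mult_left_mono integral_le integrable_continuous_real
      continuous_on_power continuous_on_mult_left c)
    fix t assume t: "t \<in> {a..b}"
    let ?z = "(s, t)"
    have "\<bar>\<tau>\<bar> * \<bar>s\<bar> * (A ?z)\<^sup>2 \<le> V ?z * (A ?z)\<^sup>2"
      by (intro mult_right_mono le_V) simp
    then have "\<bar>\<tau>\<bar> * \<bar>s\<bar> * (A ?z)\<^sup>2 \<le> 2 * D ?z" using A_square_le[of ?z] by simp
    then have "(A ?z)\<^sup>2 \<le> 2 * D ?z / (\<bar>\<tau>\<bar> * \<bar>s\<bar>)"
      using pos by (simp add: le_divide_eq mult.commute)
    then have "(\<phi> (w ?z))\<^sup>2 * (A ?z)\<^sup>2 \<le> (M\<^sup>2 / 2 * \<phi>' (w ?z)) * (2 * D ?z / (\<bar>\<tau>\<bar> * \<bar>s\<bar>))"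
      using M[OF t] \<phi>'_nonneg by (intro mult_mono) auto
    then show "(\<phi> (w ?z) * A ?z)\<^sup>2 \<le> M\<^sup>2 / (\<bar>\<tau>\<bar> * \<bar>s\<bar>) * (\<phi>' (w ?z) * D ?z)"
      by (simp add: power_mult_distrib mult_ac)
  qed (use a_less_b in auto)
  also have "\<dots> = (b - a) * M\<^sup>2 / (\<bar>\<tau>\<bar> * \<bar>s\<bar>) * energy s"
    by (simp add: energy_def)
  finally show ?thesis .
qed

lemma has_integral_cutoff:
  assumes "a \<le> c" "c \<le> d" "d \<le> b"
  shows "((\<lambda>t. \<phi>' (w (s, t)) * wt (s, t)) has_integral \<phi> (w (s, d)) - \<phi> (w (s, c))) {c..d}"
proof (rule fundamental_theorem_of_calculus_interior[OF assms(2)])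
  have "continuous_on {a..b} (\<lambda>t. \<phi> (w (s, t)))"
    by (intro continuous_on_compose2[OF cont_\<phi>] cont_slice[OF cont_w]) auto
  then show "continuous_on {c..d} (\<lambda>t. \<phi> (w (s, t)))"
    by (rule continuous_on_subset) (use assms in auto)
  fix t assume "t \<in> {c<..<d}"
  then have t: "a < t" "t < b" using assms by auto
  show "((\<lambda>t. \<phi> (w (s, t))) has_vector_derivative \<phi>' (w (s, t)) * wt (s, t)) (at t)"
    unfolding has_real_derivative_iff_has_vector_derivative[symmetric]
    by (intro DERIV_chain2[OF deriv_\<phi>] w_deriv_t t)
qed

text \<open>Far out in the strip, \<open>D\<close> controls \<open>wt\<close> from one side, depending on the sign of the second
  component \<open>- \<tau> s\<close> of \<open>G0\<close>.\<close>

lemma wt_le: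
  assumes t: "t \<in> {a..b}" and s: "2 * sqrt (1 + (\<bar>\<tau>\<bar> * max \<bar>a\<bar> \<bar>b\<bar>)\<^sup>2) \<le> \<bar>\<tau>\<bar> * \<bar>s\<bar>"
  shows "0 \<le> \<tau> * s \<Longrightarrow> wt (s, t) \<le> \<bar>\<tau>\<bar> * \<bar>s\<bar> + 2 * D (s, t)"
    and "\<tau> * s \<le> 0 \<Longrightarrow> - wt (s, t) \<le> \<bar>\<tau>\<bar> * \<bar>s\<bar> + 2 * D (s, t)"
proof -
  have "\<bar>\<tau> * t\<bar> \<le> \<bar>\<tau>\<bar> * max \<bar>a\<bar> \<bar>b\<bar>"
    unfolding abs_mult using t by (intro mult_left_mono) auto
  then have "(\<tau> * t)\<^sup>2 \<le> (\<bar>\<tau>\<bar> * max \<bar>a\<bar> \<bar>b\<bar>)\<^sup>2"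
    by (metis abs_ge_zero power2_abs power_mono)
  then have "2 * sqrt (1 + (\<tau> * t)\<^sup>2) \<le> 2 * sqrt (1 + (\<bar>\<tau>\<bar> * max \<bar>a\<bar> \<bar>b\<bar>)\<^sup>2)"
    by simp
  with s le_V[of s t] have V: "2 * sqrt (1 + (\<tau> * t)\<^sup>2) \<le> V (s, t)" by linarith
  have abs: "\<bar>\<tau>\<bar> * \<bar>s\<bar> = \<bar>\<tau> * s\<bar>" by (simp add: abs_mult)
  show "wt (s, t) \<le> \<bar>\<tau>\<bar> * \<bar>s\<bar> + 2 * D (s, t)" if "0 \<le> \<tau> * s"
    using unit_normal_coercive[where q = "- (\<tau> * s)" and p = "\<tau> * t"
        and P = "ws (s, t) + \<tau> * t" and Q = "wt (s, t) - \<tau> * s"] that V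
    unfolding D_eq A_def B_def V_def W_def abs by simp
  show "- wt (s, t) \<le> \<bar>\<tau>\<bar> * \<bar>s\<bar> + 2 * D (s, t)" if "\<tau> * s \<le> 0"
    using unit_normal_coercive[where q = "\<tau> * s" and p = "\<tau> * t"
        and P = "ws (s, t) + \<tau> * t" and Q = "- (wt (s, t) - \<tau> * s)"] that V
    unfolding D_eq A_def B_def V_def W_def abs power2_minus by (simp add: algebra_simps)
qed

text \<open>A one-sided bound for \<open>wt\<close> is enough to bound \<open>\<phi>(w)\<close>, since \<open>w\<close> vanishes at both ends of the
  cross-section: integrate from \<open>a\<close> if \<open>wt\<close> is bounded above and from \<open>b\<close> if it is bounded below.\<close>

lemma cutoff_le_energy:
  assumes y: "y \<in> {a..b}" and s: "2 * sqrt (1 + (\<bar>\<tau>\<bar> * max \<bar>a\<bar> \<bar>b\<bar>)\<^sup>2) \<le> \<bar>\<tau>\<bar> * \<bar>s\<bar>"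
    and c: "\<And>z. \<phi>' z \<le> c"
  shows "\<phi> (w (s, y)) \<le> (b - a) * c * \<bar>\<tau>\<bar> * \<bar>s\<bar> + 2 * energy s"
proof -
  define g where "g t = c * (\<bar>\<tau>\<bar> * \<bar>s\<bar>) + 2 * (\<phi>' (w (s, t)) * D (s, t))" for t
  have c0: "0 \<le> c" using order_trans[OF \<phi>'_nonneg c] .
  have g0: "0 \<le> g t" for t
    unfolding g_def using c0 \<phi>'_nonneg D_nonneg by (intro add_nonneg_nonneg mult_nonneg_nonneg) auto
  have "continuous_on {a..b} (\<lambda>t. \<phi>' (w (s, t)) * D (s, t))"
    by (intro cont_slice[OF cont_\<phi>'_mult[OF cont_D]])
  then have int1: "(\<lambda>t. \<phi>' (w (s, t)) * D (s, t)) integrable_on {a..b}"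
    by (rule integrable_continuous_real)
  then have int: "g integrable_on {a..b}" unfolding g_def
    by (intro integrable_add integrable_on_mult_right) auto
  have ig: "integral {a..b} g = (b - a) * c * \<bar>\<tau>\<bar> * \<bar>s\<bar> + 2 * energy s"
    using has_integral_add[OF has_integral_const_real[of "c * (\<bar>\<tau>\<bar> * \<bar>s\<bar>)" a b]
        has_integral_mult_right[OF integrable_integral[OF int1], of 2]] a_less_b
    unfolding g_def energy_def by (intro integral_unique) (simp add: mult_ac)
  have step: "\<phi>' (w (s, t)) * v \<le> g t" if "v \<le> \<bar>\<tau>\<bar> * \<bar>s\<bar> + 2 * D (s, t)" for v t
  proof -
    have "\<phi>' (w (s, t)) * v \<le> \<phi>' (w (s, t)) * (\<bar>\<tau>\<bar> * \<bar>s\<bar>) + 2 * (\<phi>' (w (s, t)) * D (s, t))"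
      using mult_left_mono[OF that \<phi>'_nonneg[of "w (s, t)"]] by (simp add: algebra_simps)
    also have "\<dots> \<le> g t"
      unfolding g_def by (intro add_right_mono mult_right_mono c) auto
    finally show ?thesis .
  qed
  have sub: "integral {c..d} g \<le> integral {a..b} g" if "a \<le> c" "d \<le> b" for c d
    using that int g0 by (intro integral_subset_le integrable_on_subinterval[OF int]) auto
  show ?thesis
  proof (cases "0 \<le> \<tau> * s")
    case True
    have "\<phi> (w (s, y)) - \<phi> (w (s, a)) \<le> integral {a..y} g"
    proof (rule has_integral_le[OF has_integral_cutoff])
      show "(g has_integral integral {a..y} g) {a..y}"
        using y by (intro integrable_integral integrable_on_subinterval[OF int]) auto
    qed (use y s True in \<open>auto intro!: step wt_le(1)\<close>)
    then show ?thesis using sub[of a y] y eps ig by (simp add: w_bottom \<phi>_0)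
  next
    case False
    have "- (\<phi> (w (s, b)) - \<phi> (w (s, y))) \<le> integral {y..b} g"
    proof (rule has_integral_le[OF has_integral_neg[OF has_integral_cutoff]])
      show "(g has_integral integral {y..b} g) {y..b}"
        using y by (intro integrable_integral integrable_on_subinterval[OF int]) auto
      show "- (\<phi>' (w (s, t)) * wt (s, t)) \<le> g t" if "t \<in> {y..b}" for t
        using step[OF wt_le(2)[OF _ s], of t] that y False by auto
    qed (use y in auto)
    then show ?thesis using sub[of y b] y eps ig by (simp add: w_top \<phi>_0)
  qed
qed

lemma cutoff_eq_0_if_energy_eq_0:
  assumes "energy s = 0" "t \<in> {a..b}"
  shows "\<phi> (w (s, t)) = 0"
proof -
  have "\<phi>' (w (s, t)) * D (s, t) = 0" if "t \<in> {a..b}" for t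
    using assms(1) that integral_eq_0_iff[OF cont_slice[OF cont_\<phi>'_mult[OF cont_D]], of s] a_less_b
    by (auto simp: energy_def \<phi>'_nonneg D_nonneg)
  then have 0: "\<phi>' (w (s, t)) * wt (s, t) = 0" if "t \<in> {a..b}" for t
    using that D_eq_0 by fastforce
  have "((\<lambda>t. \<phi>' (w (s, t)) * wt (s, t)) has_integral 0) {a..t}"
    by (rule has_integral_is_0) (use 0 assms in auto)
  with has_integral_cutoff[of a t s] assms have "\<phi> (w (s, t)) - \<phi> (w (s, a)) = 0"
    by (metis atLeastAtMost_iff has_integral_unique order_refl)
  then show ?thesis using eps by (simp add: w_bottom \<phi>_0)
qed

end

text \<open>The cutoffs \<open>\<phi> k\<close> are the ramp, started at \<open>\<epsilon>\<close> and stretched by the factor \<open>k\<close>. If \<open>k\<close> is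
  large compared to \<open>\<bar>s\<bar>\<close>, a small energy of \<open>\<phi> k\<close> on a cross-section far out bounds \<open>w\<close> there by
  \<open>\<epsilon> + k\<close>, and this bound enters the flux estimate for \<open>\<phi> 1\<close>.\<close>

lemma w_nonpos:
  assumes y: "y \<in> {a..b}"
  shows "w (x, y) \<le> 0"
proof (rule field_le_epsilon)
  fix \<epsilon> :: real assume eps: "0 < \<epsilon>"
  define \<phi> where "\<phi> k z = ramp ((z - \<epsilon>) / k)" for k z
  define \<phi>' where "\<phi>' k z = ramp' ((z - \<epsilon>) / k) / k" for k z
  define F where "F k = flux (\<phi> k)" for k
  define F' where "F' k = energy (\<phi>' k)" for k
  have der: "(\<phi> k has_real_derivative \<phi>' k z) (at z)" if "0 < k" for k z
  proof -
    have "((\<lambda>z. (z - \<epsilon>) / k) has_real_derivative 1 / k) (at z)"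
      using that by (auto intro!: derivative_eq_intros)
    from DERIV_chain2[OF ramp_has_derivative this] show ?thesis
      unfolding \<phi>_def \<phi>'_def by simp
  qed
  have cont': "continuous_on UNIV (\<phi>' k)" if "0 < k" for k
    unfolding \<phi>'_def using that by (intro continuous_intros) auto
  have zero: "\<phi> k z = 0" "\<phi>' k z = 0" if "0 < k" "z \<le> \<epsilon>" for k z
    using that unfolding \<phi>_def \<phi>'_def by (simp_all add: ramp_nonpos ramp'_nonpos divide_nonpos_pos)
  have range: "0 \<le> \<phi> k z" "\<phi> k z \<le> 1" "0 \<le> \<phi>' k z" "\<phi>' k z \<le> 1 / k" if "0 < k" for k z
    using that ramp_nonneg ramp_le_1 ramp'_nonneg ramp'_le_1 unfolding \<phi>_def \<phi>'_def
    by (auto intro!: divide_right_mono)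
  have ctx: "cutoff \<epsilon> (\<phi> k) (\<phi>' k)" if "0 < k" for k
    unfolding cutoff_def using that eps der cont' zero range by auto
  define K1 K2 where "K1 = (b - a) * \<bar>\<tau>\<bar>" and "K2 = (b - a) / \<bar>\<tau>\<bar>"
  define K where "K = 2 + 2 * (b - a) + K1 + K2"
  have "0 < K1" "0 < K2" using a_less_b tau by (auto simp: K1_def K2_def)
  then have "2 \<le> K" "2 * (b - a) \<le> K" "K1 \<le> K" "K2 \<le> K"
    using a_less_b by (auto simp: K_def)
  note K = this[unfolded K1_def K2_def]
  define s0 where "s0 = 2 * sqrt (1 + (\<bar>\<tau>\<bar> * max \<bar>a\<bar> \<bar>b\<bar>)\<^sup>2) / \<bar>\<tau>\<bar>"
  have dF: "(F k has_real_derivative F' k s) (at s)" if "0 < k" for k s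
    unfolding F_def F'_def using flux_deriv[OF ctx[OF that]] .
  have F'0: "0 \<le> F' k s" if "0 < k" for k s
    unfolding F'_def using energy_nonneg[OF ctx[OF that]] .
  have F_le: "\<bar>F k s\<bar> \<le> K" if "0 < k" for k s
    unfolding F_def using abs_flux_le[OF ctx[OF that], of s] K by simp
  have main: "(F 1 s)\<^sup>2 \<le> K * k\<^sup>2 * F' 1 s / \<bar>s\<bar>"
    if k: "0 < k" and s: "s0 \<le> \<bar>s\<bar>" "0 < \<bar>s\<bar>" and small: "K * \<bar>s\<bar> / k + K * F' k s < 1 / 4" for k s
  proof -
    have s': "2 * sqrt (1 + (\<bar>\<tau>\<bar> * max \<bar>a\<bar> \<bar>b\<bar>)\<^sup>2) \<le> \<bar>\<tau>\<bar> * \<bar>s\<bar>"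
      using s tau unfolding s0_def by (simp add: divide_le_eq mult.commute)
    have w_le: "w (s, t) - \<epsilon> < k" if t: "t \<in> {a..b}" for t
    proof -
      have "\<phi> k (w (s, t)) \<le> (b - a) * (1 / k) * \<bar>\<tau>\<bar> * \<bar>s\<bar> + 2 * F' k s"
        unfolding F'_def
        using cutoff_le_energy[OF ctx[OF k] t s' range(4)[OF k]] .
      also have "\<dots> = (b - a) * \<bar>\<tau>\<bar> * (\<bar>s\<bar> / k) + 2 * F' k s" by simp
      also have "\<dots> \<le> K * (\<bar>s\<bar> / k) + K * F' k s"
        using K k F'0[OF k] by (intro add_mono mult_right_mono) auto
      also have "\<dots> < 1 / 4" using small by simp
      finally have "(w (s, t) - \<epsilon>) / k < 1" unfolding \<phi>_def by (rule ramp_less_quarter)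
      then show ?thesis using k by (simp add: divide_less_eq)
    qed
    have "(F 1 s)\<^sup>2 \<le> (b - a) * k\<^sup>2 / (\<bar>\<tau>\<bar> * \<bar>s\<bar>) * F' 1 s"
      unfolding F_def F'_def
    proof (rule flux_square_le[OF ctx[OF zero_less_one]])
      fix t assume t: "t \<in> {a..b}"
      have "(\<phi> 1 (w (s, t)))\<^sup>2 \<le> \<phi>' 1 (w (s, t)) * (max 0 (w (s, t) - \<epsilon>))\<^sup>2 / 2"
        unfolding \<phi>_def \<phi>'_def using ramp_square_le[of "w (s, t) - \<epsilon>"] by simp
      also have "\<dots> \<le> \<phi>' 1 (w (s, t)) * k\<^sup>2 / 2"
        using w_le[OF t] k range(3)[of 1] by (intro divide_right_mono mult_left_mono power_mono) auto
      finally show "(\<phi> 1 (w (s, t)))\<^sup>2 \<le> k\<^sup>2 / 2 * \<phi>' 1 (w (s, t))" by (simp add: mult.commute)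
    qed (use s in auto)
    also have "\<dots> = (b - a) / \<bar>\<tau>\<bar> * (k\<^sup>2 * F' 1 s / \<bar>s\<bar>)" by simp
    also have "\<dots> \<le> K * (k\<^sup>2 * F' 1 s / \<bar>s\<bar>)"
      using K F'0[of 1] by (intro mult_right_mono) auto
    finally show ?thesis by simp
  qed
  have K0: "0 < K" using K by simp
  have F_nonpos: "F 1 s \<le> 0" for s
  proof (rule flux_nonpos[of K "F 1" "F' 1" F F' s0 s])
    show "(F 1 s)\<^sup>2 \<le> K * k\<^sup>2 * F' 1 s / s"
      if "0 < k" "s0 \<le> s" "0 < s" "K * s / k + K * F' k s < 1 / 4" for k s
      using main[of k s] that by simp
  qed (simp_all add: dF F'0 F_le K0)
  \<comment> \<open>the other end of the strip: the reflected negative flux satisfies the same hypotheses\<close>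
  have F_nonneg: "- F 1 (- (- s)) \<le> 0" for s
  proof (rule flux_nonpos[of K "\<lambda>s. - F 1 (- s)" "\<lambda>s. F' 1 (- s)" "\<lambda>k s. - F k (- s)" "\<lambda>k s. F' k (- s)" s0 "- s"])
    have *: "((\<lambda>s. - F k (- s)) has_real_derivative F' k (- s)) (at s)" if "0 < k" for k s
      using DERIV_minus[OF DERIV_chain2[OF dF[OF that] DERIV_minus[OF DERIV_ident]]] by simp
    then show "((\<lambda>s. - F 1 (- s)) has_real_derivative F' 1 (- s)) (at s)" for s by simp
    show "((\<lambda>s. - F k (- s)) has_real_derivative F' k (- s)) (at s)" if "0 < k" for k s
      by (rule *[OF that])
    show "(- F 1 (- s))\<^sup>2 \<le> K * k\<^sup>2 * F' 1 (- s) / s"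
      if "0 < k" "s0 \<le> s" "0 < s" "K * s / k + K * F' k (- s) < 1 / 4" for k s
      using main[of k "- s"] that by simp
  qed (simp_all add: F'0 F_le K0)
  have "F 1 s = 0" for s using F_nonpos[of s] F_nonneg[of s] by simp
  then have "F 1 = (\<lambda>s. 0)" by (rule ext)
  with dF[of 1 x] have "((\<lambda>s. 0) has_real_derivative F' 1 x) (at x)" by simp
  then have "F' 1 x = 0" by (rule DERIV_unique[OF _ DERIV_const])
  then have "\<phi> 1 (w (x, y)) = 0"
    unfolding F'_def by (intro cutoff_eq_0_if_energy_eq_0[OF ctx[OF zero_less_one] _ y])
  then have "w (x, y) - \<epsilon> \<le> 0" unfolding \<phi>_def by (intro ramp_eq_0) simp
  then show "w (x, y) \<le> 0 + \<epsilon>" by simp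
qed

text \<open>The reflection \<open>z \<mapsto> - z\<close> of the ambient space exchanges the metrics for \<open>\<tau>\<close> and \<open>- \<tau>\<close>.\<close>

lemma strip_graph_uminus:
  "strip_graph (- \<tau>) a b (\<lambda>z. - w z) (\<lambda>z. - ws z) (\<lambda>z. - wt z) (\<lambda>z. - C z)"
proof
  fix s t assume t: "a < t" "t < b"
  have eq: "- x + - \<tau> * y = - (x + \<tau> * y)" "- x - - \<tau> * y = - (x - \<tau> * y)" for x y by simp_all
  show "((\<lambda>s. (- ws (s, t) + - \<tau> * t) / sqrt (1 + (- ws (s, t) + - \<tau> * t)\<^sup>2 + (- wt (s, t) - - \<tau> * s)\<^sup>2))
        has_real_derivative - C (s, t)) (at s)"
    using DERIV_minus[OF deriv_s[OF t, of s]] unfolding eq power2_minus minus_divide_left .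
  show "((\<lambda>t. (- wt (s, t) - - \<tau> * s) / sqrt (1 + (- ws (s, t) + - \<tau> * t)\<^sup>2 + (- wt (s, t) - - \<tau> * s)\<^sup>2))
        has_real_derivative - (- C (s, t))) (at t)"
    using DERIV_minus[OF deriv_t[OF t, of s]] unfolding eq power2_minus minus_divide_left .
  show "((\<lambda>s. - w (s, t)) has_real_derivative - ws (s, t)) (at s)"
    by (rule DERIV_minus[OF w_deriv_s[OF t]])
  show "((\<lambda>t. - w (s, t)) has_real_derivative - wt (s, t)) (at t)"
    by (rule DERIV_minus[OF w_deriv_t[OF t]])
qed (simp_all add: a_less_b tau w_bottom w_top continuous_on_minus cont_w cont_ws cont_wt cont_C)

lemma w_eq_0:
  assumes "y \<in> {a..b}" shows "w (x, y) = 0"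
  using w_nonpos[OF assms, of x] strip_graph.w_nonpos[OF strip_graph_uminus assms, of x] by simp

end

section \<open>Strips in general position\<close>

lemma has_vector_derivative_line:
  fixes f :: "'a::real_normed_vector \<Rightarrow> 'b::real_normed_vector"
  assumes "f differentiable (at (p + x *\<^sub>R v))"
  shows "((\<lambda>x. f (p + x *\<^sub>R v)) has_vector_derivative frechet_derivative f (at (p + x *\<^sub>R v)) v) (at x)"
proof -
  let ?L = "frechet_derivative f (at (p + x *\<^sub>R v))"
  have L: "(f has_derivative ?L) (at (p + x *\<^sub>R v))"
    using assms by (simp add: frechet_derivative_works)
  have "((\<lambda>x. p + x *\<^sub>R v) has_derivative (\<lambda>h. h *\<^sub>R v)) (at x)"
    by (auto intro!: derivative_eq_intros)
  from has_derivative_compose[OF this L]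
  show ?thesis
    using has_derivative_linear[OF L] by (simp add: has_vector_derivative_def linear_scale)
qed

text \<open>The clockwise rotation by a right angle; \<open>Gu\<close> is the gradient of \<open>u\<close> plus \<open>\<tau> *\<^sub>R rot\<close>.\<close>

definition rot :: "real^2 \<Rightarrow> real^2" where
  "rot p = vector [p $ 2, - (p $ 1)]"

lemma rot_nth [simp]: "rot p $ 1 = p $ 2" "rot p $ 2 = - (p $ 1)"
  by (simp_all add: rot_def)

lemma inner_real2: "x \<bullet> y = x $ 1 * y $ 1 + x $ 2 * y $ 2" for x y :: "real^2"
  by (simp add: inner_vec_def sum_2)

lemma norm1_real2: "norm n = 1 \<longleftrightarrow> n $ 1 * n $ 1 + n $ 2 * n $ 2 = 1" for n :: "real^2"
  by (simp add: norm_eq_1 inner_real2)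

lemma rot_frame:
  fixes n v :: "real^2"
  assumes "norm n = 1"
  shows "v = (rot n \<bullet> v) *\<^sub>R rot n + (n \<bullet> v) *\<^sub>R n"
    and "(norm v)\<^sup>2 = (rot n \<bullet> v)\<^sup>2 + (n \<bullet> v)\<^sup>2"
proof -
  define c d where "c = n $ 1" and "d = n $ 2"
  have cd: "c * c + d * d = 1" using assms by (simp add: norm1_real2 c_def d_def)
  have "v $ 1 = (c * c + d * d) * v $ 1" "v $ 2 = (c * c + d * d) * v $ 2" by (simp_all add: cd)
  then show *: "v = (rot n \<bullet> v) *\<^sub>R rot n + (n \<bullet> v) *\<^sub>R n"
    by (simp add: vec_eq_iff forall_2 inner_real2 algebra_simps flip: c_def d_def)
  have "(norm v)\<^sup>2 = (c * c + d * d) * (v \<bullet> v)" by (simp add: cd power2_norm_eq_inner)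
  then show "(norm v)\<^sup>2 = (rot n \<bullet> v)\<^sup>2 + (n \<bullet> v)\<^sup>2"
    by (simp add: inner_real2 power2_eq_square algebra_simps flip: c_def d_def)
qed

lemma divergence_rot_frame:
  fixes X :: "real^2 \<Rightarrow> real^2"
  assumes n: "norm n = 1" and X: "X differentiable (at p)"
  shows "divergence X p = rot n \<bullet> frechet_derivative X (at p) (rot n) + n \<bullet> frechet_derivative X (at p) n"
proof -
  let ?L = "frechet_derivative X (at p)"
  define c d where "c = n $ 1" and "d = n $ 2"
  have cd: "c * c + d * d = 1" using n by (simp add: norm1_real2 c_def d_def)
  have lin: "linear ?L" using X by (simp add: frechet_derivative_works has_derivative_linear)
  have v: "v = v $ 1 *\<^sub>R axis 1 1 + v $ 2 *\<^sub>R axis 2 1" for v :: "real^2"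
    by (simp add: vec_eq_iff forall_2 axis_def)
  have L: "?L v = v $ 1 *\<^sub>R ?L (axis 1 1) + v $ 2 *\<^sub>R ?L (axis 2 1)" for v
    by (subst v) (simp add: linear_add[OF lin] linear_scale[OF lin])
  have "divergence X p = ?L (axis 1 1) $ 1 + ?L (axis 2 1) $ 2"
    by (simp add: divergence_def trace_def jacobian_def matrix_def sum_2)
  also have "\<dots> = (c * c + d * d) * (?L (axis 1 1) $ 1 + ?L (axis 2 1) $ 2)" by (simp add: cd)
  also have "\<dots> = rot n \<bullet> ?L (rot n) + n \<bullet> ?L n"
    unfolding L[of "rot n"] L[of n] by (simp add: inner_real2 algebra_simps flip: c_def d_def)
  finally show ?thesis .
qed

lemma inner_gradient:
  assumes "u differentiable (at p)"
  shows "v \<bullet> gradient u p = frechet_derivative u (at p) v"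
proof -
  let ?L = "frechet_derivative u (at p)"
  have lin: "linear ?L" using assms by (simp add: frechet_derivative_works has_derivative_linear)
  have "v = v $ 1 *\<^sub>R axis 1 1 + v $ 2 *\<^sub>R axis 2 1"
    by (simp add: vec_eq_iff forall_2 axis_def)
  then have "?L v = v $ 1 *\<^sub>R ?L (axis 1 1) + v $ 2 *\<^sub>R ?L (axis 2 1)"
    by (metis linear_add[OF lin] linear_scale[OF lin])
  then show ?thesis by (simp add: gradient_def inner_real2)
qed

text \<open>The coordinates \<open>(s, t)\<close> are those of the orthonormal frame \<open>e = rot n\<close>, \<open>n\<close>. Rotations about the
  origin preserve the equation. The strip need not be translated to a symmetric position, as the
  estimates hold for arbitrary \<open>a\<close> and \<open>b\<close>.\<close>

lemma nil3_graph_unit_strip_eq_0: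
  fixes \<tau> a b :: real and n :: "real^2" and u :: "real^2 \<Rightarrow> real"
  defines "S \<equiv> {p. a < n \<bullet> p \<and> n \<bullet> p < b}"
  assumes tau: "\<tau> \<noteq> 0" and n: "norm n = 1" and ab: "a < b"
    and u: "nil3_minimal_graph \<tau> S u" and bdry: "\<forall>p\<in>frontier S. u p = 0"
    and p: "p \<in> closure S"
  shows "u p = 0"
proof -
  define e where "e = rot n"
  define \<gamma> where "\<gamma> z = fst z *\<^sub>R e + snd z *\<^sub>R n" for z :: "real \<times> real"
  have frame: "e \<bullet> e = 1" "n \<bullet> n = 1" "e \<bullet> n = 0" "n \<bullet> e = 0"
    using n by (simp_all add: norm1_real2 e_def inner_real2)
  have \<gamma>_inner: "e \<bullet> \<gamma> z = fst z" "n \<bullet> \<gamma> z = snd z" for z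
    by (simp_all add: \<gamma>_def inner_add_right frame)
  have \<gamma>_surj: "p = \<gamma> (e \<bullet> p, n \<bullet> p)" for p
    using rot_frame(1)[OF n, of p] by (simp add: \<gamma>_def e_def)
  have rot_\<gamma>: "e \<bullet> rot (\<gamma> z) = snd z" "n \<bullet> rot (\<gamma> z) = - fst z" for z
    using frame(1,2) by (simp_all add: \<gamma>_def e_def inner_real2 algebra_simps) (simp_all flip: distrib_left)
  have "linear \<gamma>"
    by (rule linearI) (simp_all add: \<gamma>_def algebra_simps)
  moreover have "inj \<gamma>"
    by (rule injI) (metis \<gamma>_inner prod_eqI)
  ultimately have clos: "\<gamma> ` closure T = closure (\<gamma> ` T)" for T
    by (rule closure_injective_linear_image)
  have S_eq: "S = \<gamma> ` (UNIV \<times> {a<..<b})"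
  proof (intro equalityI subsetI)
    fix p assume "p \<in> S"
    then show "p \<in> \<gamma> ` (UNIV \<times> {a<..<b})"
      by (intro image_eqI[where f = \<gamma>, OF \<gamma>_surj]) (simp add: S_def)
  qed (auto simp: S_def \<gamma>_inner)
  have closure_S: "closure S = \<gamma> ` (UNIV \<times> {a..b})"
    unfolding S_eq clos[symmetric] using ab by (simp add: closure_Times closure_greaterThanLessThan)
  have open_S: "open S"
    unfolding S_def Collect_conj_eq by (intro open_Int open_halfspace_gt open_halfspace_lt)
  have cont_\<gamma>: "continuous_on T \<gamma>" for T
    unfolding \<gamma>_def by (intro continuous_intros)
  have \<gamma>_S: "\<gamma> z \<in> S \<longleftrightarrow> a < snd z \<and> snd z < b" for z
    by (simp add: S_def \<gamma>_inner)
  have \<gamma>_boundary: "u (\<gamma> (s, t)) = 0" if "t = a \<or> t = b" for s t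
  proof -
    have "\<gamma> (s, t) \<in> closure S - S" using that ab unfolding closure_S by (auto simp: \<gamma>_S)
    then show ?thesis using bdry open_S by (simp add: frontier_def interior_open)
  qed
  have C2: "C2_on u S" and cont_u: "continuous_on (closure S) u"
    and H0: "\<And>p. p \<in> S \<Longrightarrow> nil3_mean_curvature \<tau> u p = 0"
    using u by (auto simp: nil3_minimal_graph_def)
  define du where "du v p = frechet_derivative u (at p) v" for v p
  define ddu where "ddu v v' p = frechet_derivative (du v) (at p) v'" for v v' p
  have u_diff: "u differentiable (at p)" and du_diff: "du v differentiable (at p)" if "p \<in> S" for p v
    using C2 that by (auto simp: C2_on_def C1_on_def du_def[abs_def])
  have cont_du: "continuous_on S (du v)" and cont_ddu: "continuous_on S (ddu v v')" for v v'
    using C2 by (auto simp: C2_on_def C1_on_def du_def[abs_def] ddu_def[abs_def])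
  have line_s: "((\<lambda>s. f (\<gamma> (s, t))) has_vector_derivative frechet_derivative f (at (\<gamma> (s, t))) e) (at s)"
    if "f differentiable (at (\<gamma> (s, t)))" for f :: "real^2 \<Rightarrow> 'x::real_normed_vector" and s t
    using has_vector_derivative_line[of f "t *\<^sub>R n" s e] that by (simp add: \<gamma>_def add.commute)
  have line_t: "((\<lambda>t. f (\<gamma> (s, t))) has_vector_derivative frechet_derivative f (at (\<gamma> (s, t))) n) (at t)"
    if "f differentiable (at (\<gamma> (s, t)))" for f :: "real^2 \<Rightarrow> 'x::real_normed_vector" and s t
    using has_vector_derivative_line[of f "s *\<^sub>R e" t n] that by (simp add: \<gamma>_def)
  define ws where "ws z = du e (\<gamma> z)" for z
  define wt where "wt z = du n (\<gamma> z)" for z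
  define PP where "PP p = du e p + \<tau> * (e \<bullet> rot p)" for p
  define QQ where "QQ p = du n p + \<tau> * (n \<bullet> rot p)" for p
  define WW where "WW p = sqrt (1 + (PP p)\<^sup>2 + (QQ p)\<^sup>2)" for p
  have G_eq: "nil3_G \<tau> u p = PP p *\<^sub>R e + QQ p *\<^sub>R n" if "p \<in> S" for p
  proof -
    have "v \<bullet> nil3_G \<tau> u p = du v p + \<tau> * (v \<bullet> rot p)" for v
      using inner_gradient[OF u_diff[OF that], of v]
      by (simp add: nil3_G_def du_def rot_def inner_add_right)
    then show ?thesis
      using rot_frame(1)[OF n, of "nil3_G \<tau> u p"] by (simp add: PP_def QQ_def e_def)
  qed
  have norm_G: "(norm (nil3_G \<tau> u p))\<^sup>2 = (PP p)\<^sup>2 + (QQ p)\<^sup>2" if "p \<in> S" for p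
    unfolding G_eq[OF that] power2_norm_eq_inner
    by (simp add: inner_add_left inner_add_right frame power2_eq_square)
  \<comment> \<open>\<open>X\<close> is the field whose divergence is the mean curvature; \<open>Y\<close> is the same field in the frame, as
    an expression that is visibly differentiable\<close>
  define X where "X p = nil3_G \<tau> u p /\<^sub>R sqrt (1 + (norm (nil3_G \<tau> u p))\<^sup>2)" for p
  define Y where "Y p = (PP p / WW p) *\<^sub>R e + (QQ p / WW p) *\<^sub>R n" for p
  have XY: "X p = Y p" if "p \<in> S" for p
    unfolding X_def norm_G[OF that] unfolding Y_def WW_def G_eq[OF that]
    by (simp add: scaleR_add_right add.assoc divide_inverse mult.commute)
  have WW_pos: "0 < 1 + (PP p)\<^sup>2 + (QQ p)\<^sup>2" "0 < WW p" for p
    unfolding WW_def by (simp_all add: add_pos_nonneg)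
  have lin_rot: "(\<lambda>p. v \<bullet> rot p) differentiable (at p)" for v p
    by (simp add: inner_real2 linear_imp_differentiable linearI algebra_simps)
  have PP_diff: "PP differentiable (at p)" and QQ_diff: "QQ differentiable (at p)" if "p \<in> S" for p
    unfolding PP_def[abs_def] QQ_def[abs_def] using that
    by (auto intro!: derivative_intros du_diff lin_rot)
  have WW_diff: "WW differentiable (at p)" if "p \<in> S" for p
  proof -
    have "(\<lambda>p. 1 + (PP p)\<^sup>2 + (QQ p)\<^sup>2) differentiable (at p)"
      using that by (intro derivative_intros PP_diff QQ_diff)
    then obtain L where "((\<lambda>p. 1 + (PP p)\<^sup>2 + (QQ p)\<^sup>2) has_derivative L) (at p)"
      by (auto simp: differentiable_def)
    from has_derivative_real_sqrt[OF WW_pos(1) this] show ?thesis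
      unfolding WW_def[abs_def] differentiable_def by blast
  qed
  have Y_diff: "Y differentiable (at p)" if "p \<in> S" for p
    unfolding Y_def[abs_def] using that WW_pos(2)[of p]
    by (intro derivative_intros PP_diff QQ_diff WW_diff) auto
  have X_diff: "X differentiable (at p)" if "p \<in> S" for p
    using Y_diff[OF that] has_derivative_transform_within_open[of Y _ p UNIV S X] open_S that XY
    unfolding differentiable_def by metis
  have X_div: "n \<bullet> frechet_derivative X (at p) n = - (e \<bullet> frechet_derivative X (at p) e)" if "p \<in> S" for p
  proof -
    have "divergence X p = 0"
      using H0[OF that] by (simp add: nil3_mean_curvature_def X_def[abs_def])
    then show ?thesis
      using divergence_rot_frame[OF n X_diff[OF that]] by (simp add: e_def)
  qed
  have P_eq: "PP (\<gamma> z) = ws z + \<tau> * snd z" and Q_eq: "QQ (\<gamma> z) = wt z - \<tau> * fst z" for z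
    by (simp_all add: PP_def QQ_def ws_def wt_def rot_\<gamma>)
  have eX: "e \<bullet> X (\<gamma> z) = PP (\<gamma> z) / WW (\<gamma> z)" "n \<bullet> X (\<gamma> z) = QQ (\<gamma> z) / WW (\<gamma> z)"
    if "a < snd z" "snd z < b" for z
    using that by (simp_all add: XY \<gamma>_S Y_def inner_add_right frame)
  define C where "C z = e \<bullet> frechet_derivative X (at (\<gamma> z)) e" for z
  define P' where "P' z = ddu e e (\<gamma> z)" for z
  define Q' where "Q' z = ddu n e (\<gamma> z) - \<tau>" for z
  define P where "P z = ws z + \<tau> * snd z" for z
  define Q where "Q z = wt z - \<tau> * fst z" for z
  define W where "W z = sqrt (1 + (P z)\<^sup>2 + (Q z)\<^sup>2)" for z
  have W_pos: "0 < 1 + (P z)\<^sup>2 + (Q z)\<^sup>2" "0 < W z" for z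
    unfolding W_def by (simp_all add: add_pos_nonneg)
  have W_eq: "WW (\<gamma> z) = W z" for z
    by (simp add: WW_def W_def P_def Q_def P_eq Q_eq)
  have deriv_s: "((\<lambda>s. P (s, t) / W (s, t)) has_real_derivative C (s, t)) (at s)"
    if "a < t" "t < b" for s t
    using bounded_linear.has_vector_derivative[OF bounded_linear_inner_right[of e] line_s[OF X_diff, of s t]] that
    by (simp add: \<gamma>_S eX P_eq W_eq C_def P_def flip: has_real_derivative_iff_has_vector_derivative)
  have deriv_t: "((\<lambda>t. Q (s, t) / W (s, t)) has_real_derivative - C (s, t)) (at t)"
    if t: "a < t" "t < b" for s t
  proof -
    have "((\<lambda>t. n \<bullet> X (\<gamma> (s, t))) has_real_derivative - C (s, t)) (at t)"
      using bounded_linear.has_vector_derivative[OF bounded_linear_inner_right[of n] line_t[OF X_diff, of s t]] t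
      by (simp add: \<gamma>_S X_div C_def flip: has_real_derivative_iff_has_vector_derivative)
    then show ?thesis
      by (rule has_field_derivative_transform_within_open[where S = "{a<..<b}"])
         (use t in \<open>auto simp: eX Q_eq W_eq Q_def\<close>)
  qed
  \<comment> \<open>an explicit formula for \<open>C\<close>, from which its continuity can be read off\<close>
  have C_eq: "C z = (P' z * (W z)\<^sup>2 - P z * (P z * P' z + Q z * Q' z)) / W z ^ 3"
    if z: "a < snd z" "snd z < b" for z
  proof -
    obtain s t where st: "z = (s, t)" by (cases z)
    have dws: "((\<lambda>s. ws (s, t)) has_real_derivative P' (s, t)) (at s)"
      using line_s[OF du_diff, of s t e] z st
      by (simp add: \<gamma>_S ws_def P'_def ddu_def has_real_derivative_iff_has_vector_derivative)
    have dwt: "((\<lambda>s. wt (s, t)) has_real_derivative Q' (s, t) + \<tau>) (at s)"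
      using line_s[OF du_diff, of s t n] z st
      by (simp add: \<gamma>_S wt_def Q'_def ddu_def has_real_derivative_iff_has_vector_derivative)
    have dP: "((\<lambda>s. P (s, t)) has_real_derivative P' (s, t)) (at s)"
      unfolding P_def by (auto intro!: derivative_eq_intros dws)
    have dQ: "((\<lambda>s. Q (s, t)) has_real_derivative Q' (s, t)) (at s)"
      unfolding Q_def by (auto intro!: derivative_eq_intros dwt)
    have dW: "((\<lambda>s. W (s, t)) has_real_derivative (P z * P' z + Q z * Q' z) / W z) (at s)"
      using W_pos[of z] unfolding W_def st
      by (auto intro!: derivative_eq_intros dP dQ simp: divide_simps algebra_simps)
    have "((\<lambda>s. P (s, t) / W (s, t)) has_real_derivative
        (P' z * W z - P z * ((P z * P' z + Q z * Q' z) / W z)) / (W z * W z)) (at s)"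
      using DERIV_divide[OF dP dW] W_pos(2)[of z] by (simp add: st)
    from DERIV_unique[OF deriv_s this] z st
    have "C z = (P' z * W z - P z * ((P z * P' z + Q z * Q' z) / W z)) / (W z * W z)" by simp
    also have "\<dots> = (P' z * (W z)\<^sup>2 - P z * (P z * P' z + Q z * Q' z)) / W z ^ 3"
      using W_pos(2)[of z] by (simp add: field_simps power2_eq_square power3_eq_cube)
    finally show ?thesis .
  qed
  have cont_\<gamma>': "continuous_on (UNIV \<times> {a<..<b}) (\<lambda>z. f (\<gamma> z))" if "continuous_on S f" for f :: "real^2 \<Rightarrow> real"
    by (rule continuous_on_compose2[OF that cont_\<gamma>]) (auto simp: \<gamma>_S)
  have cont_ws: "continuous_on (UNIV \<times> {a<..<b}) ws" and cont_wt: "continuous_on (UNIV \<times> {a<..<b}) wt"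
    unfolding ws_def[abs_def] wt_def[abs_def] by (auto intro!: cont_\<gamma>' cont_du)
  have cont_C: "continuous_on (UNIV \<times> {a<..<b}) C"
  proof (rule continuous_on_eq)
    have PQ: "continuous_on (UNIV \<times> {a<..<b}) P" "continuous_on (UNIV \<times> {a<..<b}) Q"
      "continuous_on (UNIV \<times> {a<..<b}) P'" "continuous_on (UNIV \<times> {a<..<b}) Q'"
      unfolding P_def[abs_def] Q_def[abs_def] P'_def[abs_def] Q'_def[abs_def]
      by (intro continuous_intros cont_ws cont_wt cont_\<gamma>' cont_ddu)+
    have "continuous_on (UNIV \<times> {a<..<b}) W"
      unfolding W_def[abs_def] by (intro continuous_intros PQ)
    then show "continuous_on (UNIV \<times> {a<..<b})
        (\<lambda>z. (P' z * (W z)\<^sup>2 - P z * (P z * P' z + Q z * Q' z)) / W z ^ 3)"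
      using W_pos(2) by (intro continuous_intros PQ) (auto simp: less_imp_neq[THEN not_sym])
  qed (auto simp: C_eq)
  interpret strip_graph \<tau> a b "\<lambda>z. u (\<gamma> z)" ws wt C
  proof
    show "continuous_on (UNIV \<times> {a..b}) (\<lambda>z. u (\<gamma> z))"
      by (rule continuous_on_compose2[OF cont_u cont_\<gamma>]) (simp add: closure_S)
    fix s t assume t: "a < t" "t < b"
    show "((\<lambda>s. u (\<gamma> (s, t))) has_real_derivative ws (s, t)) (at s)"
      using line_s[OF u_diff, of s t] t
      by (simp add: \<gamma>_S ws_def du_def has_real_derivative_iff_has_vector_derivative)
    show "((\<lambda>t. u (\<gamma> (s, t))) has_real_derivative wt (s, t)) (at t)"
      using line_t[OF u_diff, of s t] t
      by (simp add: \<gamma>_S wt_def du_def has_real_derivative_iff_has_vector_derivative)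
    show "((\<lambda>s. (ws (s, t) + \<tau> * t) / sqrt (1 + (ws (s, t) + \<tau> * t)\<^sup>2 + (wt (s, t) - \<tau> * s)\<^sup>2))
        has_real_derivative C (s, t)) (at s)"
      using deriv_s[OF t, of s] by (simp add: P_def Q_def W_def)
    show "((\<lambda>t. (wt (s, t) - \<tau> * s) / sqrt (1 + (ws (s, t) + \<tau> * t)\<^sup>2 + (wt (s, t) - \<tau> * s)\<^sup>2))
        has_real_derivative - C (s, t)) (at t)"
      using deriv_t[OF t, of s] by (simp add: P_def Q_def W_def)
  qed (use ab tau \<gamma>_boundary cont_ws cont_wt cont_C in auto)
  obtain z where "p = \<gamma> z" "snd z \<in> {a..b}" using p unfolding closure_S by auto
  then show ?thesis using w_eq_0[of "snd z" "fst z"] by simp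
qed

theorem theorem5p3:
  fixes \<tau> :: real and \<Omega> :: "(real^2) set" and u :: "real^2 \<Rightarrow> real"
  assumes "\<tau> \<noteq> 0"
    and "is_strip \<Omega>"
    and "nil3_minimal_graph \<tau> \<Omega> u"
    and "\<forall>p\<in>frontier \<Omega>. u p = 0"
  shows "\<forall>p\<in>closure \<Omega>. u p = 0"
proof -
  from \<open>is_strip \<Omega>\<close> obtain n a b
    where n: "n \<noteq> 0" and ab: "a < b" and \<Omega>: "\<Omega> = {p. a < n \<bullet> p \<and> n \<bullet> p < b}"
    unfolding is_strip_def by blast
  define m where "m = n /\<^sub>R norm n"
  have "norm m = 1" "a / norm n < b / norm n"
    using n ab by (simp_all add: m_def divide_strict_right_mono)
  moreover have "\<Omega> = {p. a / norm n < m \<bullet> p \<and> m \<bullet> p < b / norm n}"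
    using n by (simp add: \<Omega> m_def divide_less_eq less_divide_eq field_simps)
  ultimately show ?thesis
    using nil3_graph_unit_strip_eq_0[of \<tau> m "a / norm n" "b / norm n" u] assms by simp
qed

end
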